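(* Let $G=(V,E)$ be a finite simple graph with minimum vertex degree $\geq 2$ that is not a cycle graph, and let $\mathcal{L}$ be its non-backtracking Laplacian. Let $\{c_1,\ldots,c_\ell\}$ be a simple chordless cycle in $G$, and let $$\mathcal{C}:=\{[c_1,c_2],\ldots,[c_{\ell-1},c_\ell],[c_\ell,c_1]\},\qquad \mathcal{C}^{-1}:=\{[c_1,c_\ell],[c_\ell,c_{\ell-1}],\ldots,[c_2,c_1]\}.$$ Let $\mu>0$ be a real number. Then $\mathcal{L}$ admits an eigenpair of the form $(1-\frac{1}{\mu},f)$, where $f$ is a non-zero real-valued function on the oriented edges of $G$ with support contained in $\mathcal{C}\sqcup\mathcal{C}^{-1}$, if and only if $$\mu=\sqrt[\ell]{(\deg c_1-1)(\deg c_2-1)\cdots(\deg c_\ell-1)}$$ and, up to re-labeling the vertices of the cycle (by a rotation or reflection, so that $\{c_1,\ldots,c_\ell\}$ remains a cycle in this order), $\deg c_1>2$ and, for all $i\in\{2,\ldots,\ell\}$ such that $\deg c_i>2$, $$\frac{\mu}{\deg c_1-1}\prod_{j=i+1}^{\ell}\frac{\mu}{\deg c_j-1}=\frac{\mu}{\deg c_1-1}\prod_{j=2}^{i-1}\frac{\mu}{\deg c_j-1},$$ where empty products equal $1$.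
   Context: Let $G=(V,E)$ be a finite simple undirected graph with minimum degree $\ge 2$; $\deg$ denotes degree in $G$. An oriented edge of $G$ is an ordered pair $e=[v,w]$ of adjacent vertices, with input $v$ and output $w$. The non-backtracking graph $\mathcal{NB}(G)$ is the directed graph whose vertices are the oriented edges of $G$, with a directed edge $e\to e'$ if and only if the output of $e$ equals the input of $e'$ and the input of $e$ differs from the output of $e'$. Let $\mathcal{A}$ be its adjacency matrix ($\mathcal{A}_{e,e'}=1$ if $e\to e'$, and $0$ otherwise) and $\mathcal{D}$ the diagonal matrix of its outdegrees (the outdegree of $[v,w]$ is $\deg w-1$). The non-backtracking Laplacian of $G$ is $\mathcal{L}=\mathrm{Id}-\mathcal{D}^{-1}\mathcal{A}$, acting on functions on oriented edges by $\mathcal{L}f([v,w])=f([v,w])-\frac{1}{\deg w-1}\sum_{z\sim w,\,z\ne v}f([w,z])$. An eigenpair $(\lambda,f)$ of $\mathcal{L}$ means $f\ne 0$ and $\mathcal{L}f=\lambda f$. A simple chordless cycle $\{c_1,\ldots,c_\ell\}$ of length $\ell\ge 3$ in $G$ consists of distinct vertices with $c_i\sim c_{i+1}$ (indices modulo $\ell$) and no other edges of $G$ among them. A cycle graph is a graph which, as a whole, is a single cycle.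
   Formalization: The formal theorem additionally assumes that the vertices of the cycle do not form a whole connected component of G (automatic if G is connected and not a cycle graph); otherwise the claim fails at μ = 1, e.g. for the triangle in a disjoint union of a triangle and K_4. *)

theory Defs
  imports Complex_Main "Graph_Theory.Graph_Theory"
begin

text \<open>
  A finite simple undirected graph is a \<^locale>\<open>pair_graph\<close>: a finite, loop-free, symmetric
  digraph whose arcs are pairs of vertices.  So \<open>parcs G\<close> is both the (symmetric) adjacency
  relation and the set of oriented edges \<open>[v,w] = (v, w)\<close>, and the degree of a vertex is its
  out-degree.
\<close>

abbreviation deg :: "'a pair_pre_digraph \<Rightarrow> 'a \<Rightarrow> nat" where
  "deg G v \<equiv> out_degree (with_proj G) v"

definition nb_graph :: "'a pair_pre_digraph \<Rightarrow> ('a \<times> 'a) pair_pre_digraph" where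
  "nb_graph G = \<lparr> pverts = parcs G,
     parcs = {(e, e'). e \<in> parcs G \<and> e' \<in> parcs G \<and> snd e = fst e' \<and> fst e \<noteq> snd e'} \<rparr>"

definition adj_matrix :: "'v pair_pre_digraph \<Rightarrow> 'v \<Rightarrow> 'v \<Rightarrow> real" where
  "adj_matrix H x y = (if (x, y) \<in> parcs H then 1 else 0)"

text \<open>
  The operator \<open>Id - D\<^sup>-\<^sup>1 A\<close>.  Functions on oriented edges are total functions on pairs, of which
  only the values on \<open>parcs G\<close> matter.
\<close>

definition nb_laplacian :: "'a pair_pre_digraph \<Rightarrow> ('a \<times> 'a \<Rightarrow> real) \<Rightarrow> 'a \<times> 'a \<Rightarrow> real" where
  "nb_laplacian G f e = f e -
     inverse (real (out_degree (with_proj (nb_graph G)) e)) *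
       (\<Sum>e'\<in>parcs G. adj_matrix (nb_graph G) e e' * f e')"

definition nb_eigenpair :: "'a pair_pre_digraph \<Rightarrow> real \<Rightarrow> ('a \<times> 'a \<Rightarrow> real) \<Rightarrow> bool" where
  "nb_eigenpair G lam f \<longleftrightarrow>
     (\<exists>e\<in>parcs G. f e \<noteq> 0) \<and> (\<forall>e\<in>parcs G. nb_laplacian G f e = lam * f e)"

text \<open>
  Cycles are indexed by \<open>1, \<dots>, l\<close>; the cyclic successor of the index \<open>i\<close> is \<open>i mod l + 1\<close>.
\<close>

definition simple_chordless_cycle :: "'a pair_pre_digraph \<Rightarrow> nat \<Rightarrow> (nat \<Rightarrow> 'a) \<Rightarrow> bool" where
  "simple_chordless_cycle G l c \<longleftrightarrow>
     3 \<le> l \<and> c ` {1..l} \<subseteq> pverts G \<and> inj_on c {1..l} \<and>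
     (\<forall>i\<in>{1..l}. \<forall>j\<in>{1..l}. (c i, c j) \<in> parcs G \<longleftrightarrow> j = i mod l + 1 \<or> i = j mod l + 1)"

definition cycle_edges :: "nat \<Rightarrow> (nat \<Rightarrow> 'a) \<Rightarrow> ('a \<times> 'a) set" where
  "cycle_edges l c = (\<lambda>i. (c i, c (i mod l + 1))) ` {1..l}"

definition cycle_graph :: "'a pair_pre_digraph \<Rightarrow> bool" where
  "cycle_graph G \<longleftrightarrow> (\<exists>l c. 3 \<le> l \<and> inj_on c {1..l} \<and> pverts G = c ` {1..l} \<and>
     parcs G = cycle_edges l c \<union> (cycle_edges l c)\<inverse>)"

text \<open>
  \<open>c'\<close> is \<open>c\<close> relabelled by a rotation (first disjunct) or a reflection (second disjunct) of the
  cyclically ordered index set \<open>{1..l}\<close>.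
\<close>

definition cycle_relabeling :: "nat \<Rightarrow> (nat \<Rightarrow> 'a) \<Rightarrow> (nat \<Rightarrow> 'a) \<Rightarrow> bool" where
  "cycle_relabeling l c c' \<longleftrightarrow>
     (\<exists>k<l. (\<forall>i\<in>{1..l}. c' i = c ((i - 1 + k) mod l + 1)) \<or>
            (\<forall>i\<in>{1..l}. c' i = c ((l - i + k) mod l + 1)))"

lemma out_degree_nb_graph:
  assumes "pair_graph G" and vw: "(v, w) \<in> parcs G"
  shows "out_degree (with_proj (nb_graph G)) (v, w) = deg G w - 1"
proof -
  interpret pair_graph G by fact
  have wv: "(w, v) \<in> parcs G" using vw by (meson arcs_symmetric)
  have "out_arcs (with_proj (nb_graph G)) (v, w) = Pair (v, w) ` (out_arcs (with_proj G) w - {(w, v)})"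
    using vw by (auto simp: out_arcs_def nb_graph_def)
  hence "out_degree (with_proj (nb_graph G)) (v, w) = card (out_arcs (with_proj G) w - {(w, v)})"
    by (simp add: out_degree_def card_image inj_on_def)
  also have "\<dots> = deg G w - 1"
    using wv by (simp add: out_degree_def out_arcs_def)
  finally show ?thesis .
qed

lemma nb_laplacian_eq:
  assumes "pair_graph G" and vw: "(v, w) \<in> parcs G" and "2 \<le> deg G w"
  shows "nb_laplacian G f (v, w) =
    f (v, w) - 1 / (real (deg G w) - 1) * (\<Sum>z | (w, z) \<in> parcs G \<and> z \<noteq> v. f (w, z))"
proof -
  interpret pair_graph G by fact
  have "(\<Sum>e'\<in>parcs G. adj_matrix (nb_graph G) (v, w) e' * f e')
      = (\<Sum>e'\<in>Pair w ` {z. (w, z) \<in> parcs G \<and> z \<noteq> v}. f e')"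
    using vw by (intro sum.mono_neutral_cong_right) (auto simp: adj_matrix_def nb_graph_def pair_finite_arcs)
  also have "\<dots> = (\<Sum>z | (w, z) \<in> parcs G \<and> z \<noteq> v. f (w, z))"
    by (subst sum.reindex) (auto simp: inj_on_def)
  finally show ?thesis
    using assms by (simp add: nb_laplacian_def out_degree_nb_graph of_nat_diff inverse_eq_divide)
qed

text \<open>
  In a connected graph other than a cycle graph, a chordless cycle is never a whole connected
  component.  (\<open>sccs_verts\<close> is the set of vertex sets of strongly connected components; for the
  symmetric digraphs used here these are the connected components.)  In a disconnected graph it
  may be one; then all its degrees are 2 and the constant functions on its oriented edges have
  eigenvalue 0.
\<close>

lemma cycle_not_component:
  assumes "pair_graph G" and "connected (with_proj G)" and "\<not> cycle_graph G"
    and cyc: "simple_chordless_cycle G l c"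
  shows "c ` {1..l} \<notin> pre_digraph.sccs_verts (with_proj G)"
proof
  interpret pair_graph G by fact
  let ?S = "c ` {1..l}"
  assume S: "?S \<in> pre_digraph.sccs_verts (with_proj G)"
  have l: "3 \<le> l" and sub: "?S \<subseteq> pverts G" and inj: "inj_on c {1..l}"
    and adj: "\<And>i j. i \<in> {1..l} \<Longrightarrow> j \<in> {1..l} \<Longrightarrow>
      (c i, c j) \<in> parcs G \<longleftrightarrow> j = i mod l + 1 \<or> i = j mod l + 1"
    using cyc by (auto simp: simple_chordless_cycle_def)
  have sc: "strongly_connected (with_proj G)"
    using sym_arcs assms(2) by (rule symmetric_connected_imp_strongly_connected)
  have "pverts G \<subseteq> ?S"
  proof
    fix v assume v: "v \<in> pverts G"
    have c1: "c 1 \<in> ?S" using l by auto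
    hence "c 1 \<rightarrow>\<^sup>*\<^bsub>with_proj G\<^esub> v \<and> v \<rightarrow>\<^sup>*\<^bsub>with_proj G\<^esub> c 1"
      using sc v sub by (auto simp: strongly_connected_def)
    thus "v \<in> ?S" using S c1 unfolding sccs_verts_def by blast
  qed
  hence V: "pverts G = ?S" using sub by blast
  have "parcs G = cycle_edges l c \<union> (cycle_edges l c)\<inverse>"
  proof (intro equalityI subsetI)
    fix e assume e: "e \<in> parcs G"
    then obtain i j where ij: "i \<in> {1..l}" "j \<in> {1..l}" "e = (c i, c j)"
      using V arc_fst_in_verts[OF e] arc_snd_in_verts[OF e] by (metis imageE prod.collapse)
    thus "e \<in> cycle_edges l c \<union> (cycle_edges l c)\<inverse>"
      using adj[of i j] e by (auto simp: cycle_edges_def)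
  next
    have succ: "i mod l + 1 \<in> {1..l}" for i
      using l mod_less_divisor[of l i] by (simp add: Suc_le_eq)
    fix e assume "e \<in> cycle_edges l c \<union> (cycle_edges l c)\<inverse>"
    then obtain i where i: "i \<in> {1..l}"
      and "e = (c i, c (i mod l + 1)) \<or> e = (c (i mod l + 1), c i)"
      by (auto simp: cycle_edges_def)
    thus "e \<in> parcs G" using adj[OF i succ[of i]] adj[OF succ[of i] i] by auto
  qed
  hence "cycle_graph G" using l inj V unfolding cycle_graph_def by blast
  thus False using assms(3) by simp
qed

end

theory Submission
  imports Defs
begin

text \<open>
  Write \<open>a\<^sub>i = f [c\<^sub>i, c\<^sub>i\<^sub>+\<^sub>1]\<close>, \<open>b\<^sub>i = f [c\<^sub>i, c\<^sub>i\<^sub>-\<^sub>1]\<close> and \<open>d\<^sub>i = deg c\<^sub>i - 1\<close>.  For \<open>f\<close> supported on the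
  cycle, the eigenvalue equation at an edge \<open>[v, c\<^sub>i]\<close> reads \<open>d\<^sub>i a\<^sub>i\<^sub>-\<^sub>1 = \<mu> a\<^sub>i\<close> if \<open>v = c\<^sub>i\<^sub>-\<^sub>1\<close>,
  \<open>d\<^sub>i b\<^sub>i\<^sub>+\<^sub>1 = \<mu> b\<^sub>i\<close> if \<open>v = c\<^sub>i\<^sub>+\<^sub>1\<close>, and \<open>0 = a\<^sub>i + b\<^sub>i\<close> if \<open>v\<close> is off the cycle, which happens exactly
  when \<open>deg c\<^sub>i > 2\<close>.  The two recursions determine \<open>a\<close> and \<open>b\<close> from \<open>a\<^sub>1\<close> and \<open>b\<^sub>1\<close> and close up around
  the cycle iff \<open>\<mu> ^ l\<close> is the product of the \<open>d\<^sub>i\<close>.  Some vertex of the cycle has degree \<open>> 2\<close>, because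
  the cycle is not a component; starting there, \<open>b\<^sub>1 = - a\<^sub>1\<close>, and \<open>a\<^sub>i + b\<^sub>i = 0\<close> becomes the stated
  condition.
\<close>

section \<open>Cyclic index arithmetic and adjacency along the cycle\<close>

text \<open>The setting is a locale so that every result can be instantiated both at the given
  labelling and at a relabelled one.\<close>

locale chordless_cycle = pair_graph G for G :: "'a pair_pre_digraph" +
  fixes l :: nat and c :: "nat \<Rightarrow> 'a"
  assumes cycle: "simple_chordless_cycle G l c"
    and min_degree: "\<And>v. v \<in> pverts G \<Longrightarrow> 2 \<le> deg G v"
begin

definition succ :: "nat \<Rightarrow> nat" where "succ i = i mod l + 1"

definition pred :: "nat \<Rightarrow> nat" where "pred i = (if i = 1 then l else i - 1)"

lemma length_ge_3: "3 \<le> l"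
  and vertices: "c ` {1..l} \<subseteq> pverts G"
  and inj_c: "inj_on c {1..l}"
  and arc_iff: "\<And>i j. i \<in> {1..l} \<Longrightarrow> j \<in> {1..l} \<Longrightarrow>
    (c i, c j) \<in> parcs G \<longleftrightarrow> j = succ i \<or> i = succ j"
  using cycle by (auto simp: simple_chordless_cycle_def succ_def)

lemma succ_eq: "i \<in> {1..l} \<Longrightarrow> succ i = (if i = l then 1 else i + 1)"
  by (auto simp: succ_def)

text \<open>The bound \<open>3 \<le> l\<close> is what separates \<open>succ i\<close> from
  \<open>pred i\<close>, so each cycle vertex has two distinct neighbours on the cycle.\<close>

lemma
  assumes "i \<in> {1..l}"
  shows succ_in [simp]: "succ i \<in> {1..l}" and pred_in [simp]: "pred i \<in> {1..l}"
    and succ_pred [simp]: "succ (pred i) = i" and pred_succ [simp]: "pred (succ i) = i"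
    and succ_neq_pred: "succ i \<noteq> pred i"
proof -
  have *: "1 \<le> i" "i \<le> l" "3 \<le> l" using assms length_ge_3 by auto
  show 1: "succ i \<in> {1..l}" "pred i \<in> {1..l}"
    using * by (auto simp: succ_eq pred_def)
  show "succ (pred i) = i" "pred (succ i) = i" "succ i \<noteq> pred i"
    using * 1 by (auto simp: succ_eq pred_def split: if_splits)
qed

lemma arc_pred_succ_iff:
  assumes "i \<in> {1..l}" and "j \<in> {1..l}"
  shows "(c i, c j) \<in> parcs G \<longleftrightarrow> j = succ i \<or> j = pred i"
  using assms arc_iff[OF assms] by (metis pred_succ succ_pred)

lemma c_eq_iff [simp]: "i \<in> {1..l} \<Longrightarrow> j \<in> {1..l} \<Longrightarrow> c i = c j \<longleftrightarrow> i = j"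
  using inj_c by (auto dest: inj_onD)

lemma c_succ_neq_c_pred: "i \<in> {1..l} \<Longrightarrow> c (succ i) \<noteq> c (pred i)"
  by (metis c_eq_iff pred_in succ_in succ_neq_pred)

text \<open>Chordlessness excludes further cycle neighbours; sums over the edges leaving
  \<open>c i\<close> thereby shrink to two terms when the function is supported on the
  cycle.\<close>

lemma neighbours_on_cycle:
  assumes "i \<in> {1..l}"
  shows "{z. (c i, z) \<in> parcs G \<and> z \<in> c ` {1..l}} = {c (succ i), c (pred i)}"
  using assms arc_pred_succ_iff[OF assms] succ_in[OF assms] pred_in[OF assms] by blast

text \<open>By chordlessness the support condition depends on the vertex set of the cycle alone. It
  can thus be checked endpoint by endpoint and survives relabelling.\<close>

lemma cycle_edges_Un_converse:
  "cycle_edges l c \<union> (cycle_edges l c)\<inverse> = {e \<in> parcs G. fst e \<in> c ` {1..l} \<and> snd e \<in> c ` {1..l}}"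
proof -
  have "cycle_edges l c = (\<lambda>i. (c i, c (succ i))) ` {1..l}"
    by (simp add: cycle_edges_def succ_def)
  then show ?thesis
    using arc_iff succ_in by (auto simp: image_iff)
qed

section \<open>Degrees on the cycle and the component condition\<close>

lemma degree_eq: "deg G v = card {z. (v, z) \<in> parcs G}"
proof -
  have "out_arcs (with_proj G) v = Pair v ` {z. (v, z) \<in> parcs G}"
    by (auto simp: out_arcs_def)
  then show ?thesis by (simp add: out_degree_def card_image inj_on_def)
qed

lemma finite_neighbours: "finite {z. (v, z) \<in> parcs G}"
proof -
  have "{z. (v, z) \<in> parcs G} \<subseteq> snd ` parcs G" by force
  then show ?thesis using pair_finite_arcs finite_surj by blast
qed

text \<open>Exactly two neighbours of \<open>c i\<close> lie on the cycle, so a third one must lie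
  off it; symmetry of the arcs turns it into an edge entering \<open>c i\<close>.\<close>

lemma degree_gt_2_iff:
  assumes i: "i \<in> {1..l}"
  shows "2 < deg G (c i) \<longleftrightarrow> (\<exists>v. (v, c i) \<in> parcs G \<and> v \<notin> c ` {1..l})"
proof -
  let ?N = "{z. (c i, z) \<in> parcs G}" and ?M = "{c (succ i), c (pred i)}"
  have sub: "?M \<subseteq> ?N" using neighbours_on_cycle[OF i] by blast
  have "card ?M = 2" using c_succ_neq_c_pred[OF i] by simp
  then have "2 < deg G (c i) \<longleftrightarrow> ?M \<noteq> ?N"
    using sub finite_neighbours[of "c i"] card_subset_eq[of ?N ?M] psubset_card_mono[of ?N ?M]
    by (auto simp: degree_eq)
  also have "\<dots> \<longleftrightarrow> (\<exists>v. (c i, v) \<in> parcs G \<and> v \<notin> c ` {1..l})"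
    using neighbours_on_cycle[OF i] by blast
  also have "\<dots> \<longleftrightarrow> (\<exists>v. (v, c i) \<in> parcs G \<and> v \<notin> c ` {1..l})"
    by (meson arcs_symmetric)
  finally show ?thesis .
qed

lemma connected_on_cycle:
  assumes "i \<in> {1..l}"
  shows "c 1 \<rightarrow>\<^sup>*\<^bsub>with_proj G\<^esub> c i \<and> c i \<rightarrow>\<^sup>*\<^bsub>with_proj G\<^esub> c 1"
  using assms
proof (induction i)
  case (Suc i)
  \<comment> \<open>Index 0 is out of range, so the induction really starts at
    \<open>Suc i = 1\<close>, which is the case \<open>i = 0\<close> here.\<close>
  show ?case
  proof (cases "i = 0")
    case True
    have "c 1 \<in> pverts G" using vertices length_ge_3 by auto
    with True show ?thesis by simp
  next
    case False
    with Suc.prems have i: "i \<in> {1..l}" "Suc i \<in> {1..l}" "Suc i = succ i"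
      by (auto simp: succ_eq)
    then have adj: "(c i, c (Suc i)) \<in> parcs G" "(c (Suc i), c i) \<in> parcs G"
      using arc_iff by auto
    show ?thesis
      using Suc.IH[OF i(1)] reachable_adj_trans[OF _ adj(1)] adj_reachable_trans[OF adj(2)]
      by simp
  qed
qed simp

text \<open>If all degrees on the cycle were 2, no arc would leave it. Being closed under
  reachability and mutually reachable, the cycle would be a component.\<close>

lemma exists_degree_gt_2:
  assumes "c ` {1..l} \<notin> pre_digraph.sccs_verts (with_proj G)"
  shows "\<exists>i\<in>{1..l}. 2 < deg G (c i)"
proof (rule ccontr)
  assume low: "\<not> ?thesis"
  have closed: "w \<in> c ` {1..l}" if vw: "v \<in> c ` {1..l}" "(v, w) \<in> parcs G" for v w
  proof -
    obtain i where "i \<in> {1..l}" "v = c i" using vw by blast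
    moreover have "(w, v) \<in> parcs G" using vw(2) by (rule arcs_symmetric)
    ultimately show ?thesis using low degree_gt_2_iff by blast
  qed
  have "v \<in> c ` {1..l}" if "u \<rightarrow>\<^sup>*\<^bsub>with_proj G\<^esub> v" "u \<in> c ` {1..l}" for u v
    using that
  proof (induction rule: reachable_induct)
    case (step v w)
    from step(2) have "(v, w) \<in> parcs G" by (auto simp: arcs_ends_def arc_to_ends_def)
    with step closed show ?case by blast
  qed
  moreover have "u \<rightarrow>\<^sup>*\<^bsub>with_proj G\<^esub> v" if "u \<in> c ` {1..l}" "v \<in> c ` {1..l}" for u v
    using that connected_on_cycle by (blast intro: reachable_trans)
  moreover have "c ` {1..l} \<noteq> {}" using length_ge_3 by auto
  ultimately have "c ` {1..l} \<in> pre_digraph.sccs_verts (with_proj G)"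
    unfolding pre_digraph.sccs_verts_def by blast
  with assms show False by contradiction
qed

section \<open>The eigenvalue equation for functions supported on the cycle\<close>

lemma degree_minus_1_pos: "i \<in> {1..l} \<Longrightarrow> 0 < real (deg G (c i)) - 1"
  using min_degree[of "c i"] vertices by (fastforce simp del: atLeastAtMost_iff)

text \<open>The vertex \<open>v\<close> is arbitrary so that one formula serves edges entering
  \<open>c i\<close> from \<open>c (pred i)\<close>, from \<open>c (succ i)\<close> and from off the
  cycle.\<close>

lemma sum_out_edges:
  assumes f: "\<And>e. e \<in> parcs G \<Longrightarrow> f e \<noteq> 0 \<Longrightarrow> snd e \<in> c ` {1..l}" and i: "i \<in> {1..l}"
  shows "(\<Sum>z | (c i, z) \<in> parcs G \<and> z \<noteq> v. f (c i, z)) =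
    (if v = c (succ i) then 0 else f (c i, c (succ i))) +
    (if v = c (pred i) then 0 else (f (c i, c (pred i)) :: real))"
proof -
  have "(\<Sum>z | (c i, z) \<in> parcs G \<and> z \<noteq> v. f (c i, z)) =
      (\<Sum>z\<in>{c (succ i), c (pred i)} - {v}. f (c i, z))"
  proof (rule sum.mono_neutral_right)
    show "finite {z. (c i, z) \<in> parcs G \<and> z \<noteq> v}"
      using finite_neighbours by (rule rev_finite_subset) auto
    show "{c (succ i), c (pred i)} - {v} \<subseteq> {z. (c i, z) \<in> parcs G \<and> z \<noteq> v}"
      using neighbours_on_cycle[OF i] by blast
    show "\<forall>z\<in>{z. (c i, z) \<in> parcs G \<and> z \<noteq> v} - ({c (succ i), c (pred i)} - {v}). f (c i, z) = 0"
      using neighbours_on_cycle[OF i] f by fastforce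
  qed
  also have "\<dots> = (if v = c (succ i) then 0 else f (c i, c (succ i))) +
      (if v = c (pred i) then 0 else f (c i, c (pred i)))"
    using c_succ_neq_c_pred[OF i] by (auto simp: insert_Diff_if)
  finally show ?thesis .
qed

text \<open>With the eigenvalue written as \<open>1 - 1 / \<mu>\<close>, the identity part of the
  Laplacian cancels, and clearing the two positive denominators leaves a linear relation.\<close>

lemma eigen_equation_iff:
  fixes \<mu> :: real
  assumes vw: "(v, w) \<in> parcs G" and "0 < \<mu>"
  shows "nb_laplacian G f (v, w) = (1 - 1 / \<mu>) * f (v, w) \<longleftrightarrow>
    (real (deg G w) - 1) * f (v, w) = \<mu> * (\<Sum>z | (w, z) \<in> parcs G \<and> z \<noteq> v. f (w, z))"
proof -
  have deg: "2 \<le> deg G w" using vw by (intro min_degree) (auto dest: arc_snd_in_verts)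
  have "nb_laplacian G f (v, w) =
      f (v, w) - 1 / (real (deg G w) - 1) * (\<Sum>z | (w, z) \<in> parcs G \<and> z \<noteq> v. f (w, z))"
    using pair_graph_axioms vw deg by (rule nb_laplacian_eq)
  moreover have "x - 1 / D * S = (1 - 1 / \<mu>) * x \<longleftrightarrow> D * x = \<mu> * S" if "0 < D" for x D S :: real
    using that \<open>0 < \<mu>\<close> by (auto simp: field_simps)
  ultimately show ?thesis using deg by simp
qed

text \<open>An edge whose output is off the cycle gives \<open>0 = 0\<close>. An edge into
  \<open>c i\<close> gives one of the three conditions, according to whether its input is
  \<open>c (pred i)\<close>, \<open>c (succ i)\<close> or off the cycle.\<close>

lemma nb_eigenpair_iff:
  fixes \<mu> :: real
  assumes f: "{e \<in> parcs G. f e \<noteq> 0} \<subseteq> cycle_edges l c \<union> (cycle_edges l c)\<inverse>" and \<mu>: "0 < \<mu>"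
  defines "d \<equiv> \<lambda>i. real (deg G (c i)) - 1"
    and "a \<equiv> \<lambda>i. f (c i, c (succ i))" and "b \<equiv> \<lambda>i. f (c i, c (pred i))"
  shows "nb_eigenpair G (1 - 1 / \<mu>) f \<longleftrightarrow>
    (\<exists>i\<in>{1..l}. a i \<noteq> 0 \<or> b i \<noteq> 0) \<and>
    (\<forall>i\<in>{1..l}. d i * a (pred i) = \<mu> * a i \<and> d i * b (succ i) = \<mu> * b i \<and>
      (2 < deg G (c i) \<longrightarrow> a i + b i = 0))"
proof -
  have supp: "fst e \<in> c ` {1..l} \<and> snd e \<in> c ` {1..l}" if "e \<in> parcs G" "f e \<noteq> 0" for e
    using that f unfolding cycle_edges_Un_converse by blast
  have arcs: "(c i, c (succ i)) \<in> parcs G" "(c i, c (pred i)) \<in> parcs G" if "i \<in> {1..l}" for i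
    using that arc_pred_succ_iff[OF that] succ_in[OF that] pred_in[OF that] by blast+
  have "(\<exists>e\<in>parcs G. f e \<noteq> 0) \<longleftrightarrow> (\<exists>i\<in>{1..l}. a i \<noteq> 0 \<or> b i \<noteq> 0)"
  proof
    assume "\<exists>e\<in>parcs G. f e \<noteq> 0"
    then obtain e where e: "e \<in> parcs G" "f e \<noteq> 0" by blast
    with supp have "fst e \<in> c ` {1..l}" "snd e \<in> c ` {1..l}" by blast+
    then obtain i j where ij: "i \<in> {1..l}" "j \<in> {1..l}" "fst e = c i" "snd e = c j"
      by blast
    then have e_eq: "e = (c i, c j)" by (simp add: prod_eq_iff)
    then have "j = succ i \<or> j = pred i" using e(1) arc_pred_succ_iff[OF ij(1,2)] by simp
    with e ij(1) e_eq show "\<exists>i\<in>{1..l}. a i \<noteq> 0 \<or> b i \<noteq> 0" by (auto simp: a_def b_def)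
  next
    assume "\<exists>i\<in>{1..l}. a i \<noteq> 0 \<or> b i \<noteq> 0"
    then show "\<exists>e\<in>parcs G. f e \<noteq> 0" using arcs unfolding a_def b_def by blast
  qed
  moreover have "(\<forall>e\<in>parcs G. nb_laplacian G f e = (1 - 1 / \<mu>) * f e) \<longleftrightarrow>
    (\<forall>i\<in>{1..l}. d i * a (pred i) = \<mu> * a i \<and> d i * b (succ i) = \<mu> * b i \<and>
      (2 < deg G (c i) \<longrightarrow> a i + b i = 0))" (is "?L \<longleftrightarrow> (\<forall>i\<in>{1..l}. ?R i)")
  proof
    have eqn: "nb_laplacian G f (v, c i) = (1 - 1 / \<mu>) * f (v, c i) \<longleftrightarrow>
        d i * f (v, c i) = \<mu> * ((if v = c (succ i) then 0 else a i) + (if v = c (pred i) then 0 else b i))"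
      if "i \<in> {1..l}" "(v, c i) \<in> parcs G" for v i
      unfolding eigen_equation_iff[OF that(2) \<mu>] d_def a_def b_def
      using sum_out_edges[of f i v] supp that by simp
    have pred_succ_arcs: "(c (pred i), c i) \<in> parcs G" "(c (succ i), c i) \<in> parcs G"
      if "i \<in> {1..l}" for i
      using that arcs[OF that] by (auto intro: arcs_symmetric)
    have a_pred: "f (c (pred i), c i) = a (pred i)" and b_succ: "f (c (succ i), c i) = b (succ i)"
      if "i \<in> {1..l}" for i
      using that by (simp_all add: a_def b_def)
    show "\<forall>i\<in>{1..l}. ?R i" if L: ?L
    proof
      fix i assume i: "i \<in> {1..l}"
      have "a i + b i = 0" if "2 < deg G (c i)"
      proof -
        \<comment> \<open>The edge from \<open>v\<close> carries the value 0, while both cycle edges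
          leaving \<open>c i\<close> continue it, so its equation is that their values sum to
          0.\<close>
        obtain v where v: "(v, c i) \<in> parcs G" "v \<notin> c ` {1..l}"
          using \<open>2 < deg G (c i)\<close> degree_gt_2_iff[OF i] by blast
        then have "v \<noteq> c (succ i)" "v \<noteq> c (pred i)"
          using i by (metis imageI succ_in, metis imageI pred_in)
        moreover have "f (v, c i) = 0" using supp[OF v(1)] v(2) by auto
        ultimately show ?thesis using L v eqn[OF i v(1)] \<mu> by auto
      qed
      moreover have "d i * a (pred i) = \<mu> * a i"
        using L eqn[OF i pred_succ_arcs(1)[OF i]] pred_succ_arcs[OF i] c_succ_neq_c_pred[OF i]
        by (simp add: a_pred[OF i])
      moreover have "d i * b (succ i) = \<mu> * b i"
        using L eqn[OF i pred_succ_arcs(2)[OF i]] pred_succ_arcs[OF i] c_succ_neq_c_pred[OF i]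
        by (simp add: b_succ[OF i])
      ultimately show "?R i" by blast
    qed
    show ?L if R: "\<forall>i\<in>{1..l}. ?R i"
    proof
      fix e assume e: "e \<in> parcs G"
      obtain v w where vw: "e = (v, w)" by fastforce
      show "nb_laplacian G f e = (1 - 1 / \<mu>) * f e"
      proof (cases "w \<in> c ` {1..l}")
        case False
        then have "f (v, w) = 0" using supp[of "(v, w)"] e vw by auto
        moreover have "(\<Sum>z | (w, z) \<in> parcs G \<and> z \<noteq> v. f (w, z)) = 0"
          using supp False by (intro sum.neutral) force
        ultimately show ?thesis using eigen_equation_iff[of v w \<mu> f] e vw \<mu> by simp
      next
        case True
        then obtain i where i: "i \<in> {1..l}" "w = c i" by blast
        then have arc: "(v, c i) \<in> parcs G" using e vw by simp
        show ?thesis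
        proof (cases "v \<in> c ` {1..l}")
          case True
          then have "v = c (succ i) \<or> v = c (pred i)"
            using neighbours_on_cycle[OF i(1)] arc arcs_symmetric by blast
          then show ?thesis
            using R i c_succ_neq_c_pred[OF i(1)] eqn[OF i(1) arc]
            by (auto simp: vw a_pred b_succ)
        next
          case False
          then have "v \<noteq> c (succ i)" "v \<noteq> c (pred i)"
            using i by (metis imageI succ_in, metis imageI pred_in)
          moreover have "f (v, c i) = 0" using supp[OF arc] False by auto
          moreover have "a i + b i = 0" using R i arc False degree_gt_2_iff by blast
          ultimately show ?thesis using eqn[OF i(1) arc] by (simp add: vw i)
        qed
      qed
    qed
  qed
  ultimately show ?thesis unfolding nb_eigenpair_def by (rule conj_cong)
qed

section \<open>Cyclic linear recursions\<close>

text \<open>Unrolling from index 1 expresses every value through \<open>a 1\<close>; the equation at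
  index 1, whose predecessor is \<open>l\<close>, then closes the cycle. The factor
  \<open>a 1\<close> stays in the closing condition because it may be 0.\<close>

lemma forward_recursion_iff:
  fixes a q :: "nat \<Rightarrow> real"
  shows "(\<forall>i\<in>{1..l}. a i = q i * a (pred i)) \<longleftrightarrow>
    (\<forall>i\<in>{1..l}. a i = a 1 * prod q {2..i}) \<and> a 1 = a 1 * prod q {1..l}" (is "?L \<longleftrightarrow> ?R1 \<and> ?R2")
proof
  have prod_1: "prod q {1..l} = q 1 * prod q {2..l}"
    using length_ge_3 by (simp add: prod.atLeast_Suc_atMost numeral_2_eq_2)
  show "?R1 \<and> ?R2" if L: ?L
  proof -
    have a: "a i = a 1 * prod q {2..i}" if "1 \<le> i" "i \<le> l" for i
      using that
    proof (induction i rule: nat_induct_at_least)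
      case (Suc i)
      then have "a (Suc i) = q (Suc i) * a i" using L[rule_format, of "Suc i"] by (simp add: pred_def)
      with Suc show ?case by simp
    qed simp
    have "a l = a 1 * prod q {2..l}" by (rule a) (use length_ge_3 in simp_all)
    moreover have "a 1 = q 1 * a l"
      using L[rule_format, of 1] length_ge_3 by (simp add: pred_def)
    ultimately have a_1: "a 1 = a 1 * prod q {1..l}" unfolding prod_1 by (metis mult.left_commute)
    show ?thesis by (intro conjI ballI a a_1) simp_all
  qed
  show ?L if R: "?R1 \<and> ?R2"
  proof
    fix i assume i: "i \<in> {1..l}"
    have a: "a j = a 1 * prod q {2..j}" if "j \<in> {1..l}" for j
      using R[THEN conjunct1] that by (rule bspec)
    show "a i = q i * a (pred i)"
    proof (cases "i = 1")
      case True
      have "a 1 = q 1 * (a 1 * prod q {2..l})"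
        using R unfolding prod_1 by (metis mult.left_commute)
      also have "a 1 * prod q {2..l} = a l"
        using length_ge_3 by (intro a[symmetric]) simp
      finally show ?thesis by (simp add: True pred_def)
    next
      case False
      with i obtain k where k: "i = Suc k" "k \<in> {1..l}" by (cases i) auto
      show ?thesis unfolding a[OF i] a[OF pred_in[OF i]] using k by (simp add: pred_def)
    qed
  qed
qed

text \<open>Since the successor of \<open>l\<close> is 1, unrolling runs from \<open>l\<close> down
  to 2. At index 1 the same formula would read \<open>b 1 = b 1 * prod q {1..l}\<close>, which is
  the closing condition.\<close>

lemma backward_recursion_iff:
  fixes b q :: "nat \<Rightarrow> real"
  shows "(\<forall>i\<in>{1..l}. b i = q i * b (succ i)) \<longleftrightarrow>
    (\<forall>i\<in>{2..l}. b i = b 1 * prod q {i..l}) \<and> b 1 = b 1 * prod q {1..l}" (is "?L \<longleftrightarrow> ?R1 \<and> ?R2")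
proof
  have prod_1: "prod q {1..l} = q 1 * prod q {2..l}"
    using length_ge_3 by (simp add: prod.atLeast_Suc_atMost numeral_2_eq_2)
  have b_1: "b 1 = q 1 * b 2" if ?L
    using that[rule_format, of 1] length_ge_3 by (simp add: succ_eq numeral_2_eq_2)
  show "?R1 \<and> ?R2" if L: ?L
  proof -
    have "b i = b 1 * prod q {i..l}" if "2 \<le> i" "i \<le> l" for i
      using that(2,1)
    proof (induction i rule: inc_induct)
      case base
      then show ?case using L[rule_format, of l] by (simp add: succ_eq)
    next
      case (step i)
      then have "b i = q i * b (Suc i)" using L[rule_format, of i] by (simp add: succ_eq)
      with step show ?case by (simp add: prod.atLeast_Suc_atMost)
    qed
    with b_1[OF L] show ?thesis using length_ge_3 by (simp add: prod_1 del: One_nat_def)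
  qed
  show ?L if R: "?R1 \<and> ?R2"
  proof
    fix i assume i: "i \<in> {1..l}"
    have b: "b j = b 1 * prod q {j..l}" if "2 \<le> j" "j \<le> l" for j using R that by simp
    consider "i = 1" | "i = l" "2 \<le> i" | "2 \<le> i" "i < l" using i by force
    then show "b i = q i * b (succ i)"
    proof cases
      case 1
      have "b 1 = q 1 * (b 1 * prod q {2..l})"
        using R unfolding prod_1 by (metis mult.left_commute)
      also have "b 1 * prod q {2..l} = b 2"
        using length_ge_3 by (intro b[symmetric]) simp_all
      also have "2 = succ i" using 1 length_ge_3 by (simp add: succ_eq)
      finally show ?thesis using 1 by simp
    next
      case 2
      then have "b i = b 1 * q i" using b[of l] by simp
      with 2 show ?thesis by (simp add: succ_eq)
    next
      case 3
      have "b i = b 1 * (q i * prod q {Suc i..l})"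
        using b[of i] 3 by (simp add: prod.atLeast_Suc_atMost)
      moreover have "b (Suc i) = b 1 * prod q {Suc i..l}" using 3 by (intro b) simp_all
      moreover have "succ i = Suc i" using 3 by (simp add: succ_eq)
      ultimately show ?thesis by (metis mult.left_commute)
    qed
  qed
qed

section \<open>Existence criterion when the labelling starts at a vertex of degree above 2\<close>

text \<open>The index is recovered from the vertex by inverting \<open>c\<close>, and the two
  prescriptions cannot clash because \<open>c (succ i)\<close> and \<open>c (pred i)\<close>
  differ.\<close>

lemma function_on_cycle_exists:
  fixes A B :: "nat \<Rightarrow> real"
  obtains f where "{e \<in> parcs G. f e \<noteq> 0} \<subseteq> cycle_edges l c \<union> (cycle_edges l c)\<inverse>"
    and "\<And>i. i \<in> {1..l} \<Longrightarrow> f (c i, c (succ i)) = A i"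
    and "\<And>i. i \<in> {1..l} \<Longrightarrow> f (c i, c (pred i)) = B i"
proof
  define g where "g = the_inv_into {1..l} c"
  define f where "f = (\<lambda>(x, y).
    if x \<notin> c ` {1..l} then 0 else if y = c (succ (g x)) then A (g x)
    else if y = c (pred (g x)) then B (g x) else 0)"
  have g: "g (c i) = i" if "i \<in> {1..l}" for i
    unfolding g_def using inj_c that by (rule the_inv_into_f_f)
  show "f (c i, c (succ i)) = A i" "f (c i, c (pred i)) = B i" if "i \<in> {1..l}" for i
    using that g[OF that] c_succ_neq_c_pred[OF that, symmetric]
    by (simp_all add: f_def del: atLeastAtMost_iff)
  have "x \<in> c ` {1..l} \<and> y \<in> c ` {1..l}" if "f (x, y) \<noteq> 0" for x y
  proof -
    have x: "x \<in> c ` {1..l}" using that by (auto simp: f_def split: if_splits)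
    then have "g x \<in> {1..l}" using g by auto
    then have "c (succ (g x)) \<in> c ` {1..l}" "c (pred (g x)) \<in> c ` {1..l}"
      by (metis imageI succ_in, metis imageI pred_in)
    with that x show ?thesis by (auto simp: f_def split: if_splits)
  qed
  then show "{e \<in> parcs G. f e \<noteq> 0} \<subseteq> cycle_edges l c \<union> (cycle_edges l c)\<inverse>"
    unfolding cycle_edges_Un_converse by fastforce
qed

text \<open>The degree of \<open>c 1\<close> forces \<open>b 1 = - a 1\<close>, so a solution is
  determined by \<open>a 1\<close>. The condition \<open>a i + b i = 0\<close> then equates
  \<open>prod q {2..i}\<close> with \<open>prod q {i..l}\<close>, and the common factor
  \<open>q i\<close> cancels. Here \<open>q i\<close> is the reciprocal of the factor in the final
  statement.\<close>

lemma eigenfunction_on_cycle_iff: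
  fixes \<mu> :: real
  assumes \<mu>: "0 < \<mu>" and deg_1: "2 < deg G (c 1)"
  defines "q \<equiv> \<lambda>i. (real (deg G (c i)) - 1) / \<mu>"
  shows "(\<exists>f. nb_eigenpair G (1 - 1 / \<mu>) f \<and>
      {e \<in> parcs G. f e \<noteq> 0} \<subseteq> cycle_edges l c \<union> (cycle_edges l c)\<inverse>) \<longleftrightarrow>
    prod q {1..l} = 1 \<and>
    (\<forall>i\<in>{2..l}. 2 < deg G (c i) \<longrightarrow> prod q {i + 1..l} = prod q {2..i - 1})" (is "?L \<longleftrightarrow> ?R")
proof -
  have q_pos: "0 < q i" if "i \<in> {1..l}" for i
    using degree_minus_1_pos[OF that] \<mu> by (simp add: q_def)
  have one_in: "1 \<in> {1..l}" using length_ge_3 by simp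
  \<comment> \<open>The sequences need to agree with \<open>f\<close> only on \<open>{1..l}\<close>,
    so this applies to values read off from \<open>f\<close> and to explicitly given
    products.\<close>
  have eigen: "nb_eigenpair G (1 - 1 / \<mu>) f \<longleftrightarrow>
      (\<exists>i\<in>{1..l}. a i \<noteq> 0 \<or> b i \<noteq> 0) \<and>
      (\<forall>i\<in>{1..l}. a i = q i * a (pred i)) \<and> (\<forall>i\<in>{1..l}. b i = q i * b (succ i)) \<and>
      (\<forall>i\<in>{1..l}. 2 < deg G (c i) \<longrightarrow> a i + b i = 0)"
    if "{e \<in> parcs G. f e \<noteq> 0} \<subseteq> cycle_edges l c \<union> (cycle_edges l c)\<inverse>"
      and "\<And>i. i \<in> {1..l} \<Longrightarrow> a i = f (c i, c (succ i))"
      and "\<And>i. i \<in> {1..l} \<Longrightarrow> b i = f (c i, c (pred i))" for f a b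
  proof -
    have "(x::real) * y = \<mu> * z \<longleftrightarrow> z = x / \<mu> * y" for x y z
      using \<mu> by (auto simp: field_simps)
    with that that(2)[OF pred_in] that(3)[OF succ_in] show ?thesis
      unfolding nb_eigenpair_iff[OF that(1) \<mu>] q_def
      by (simp add: ball_conj_distrib del: atLeastAtMost_iff One_nat_def cong: ball_cong)
  qed
  have cancel: "prod q {2..i} = prod q {i..l} \<longleftrightarrow> prod q {i + 1..l} = prod q {2..i - 1}"
    if i: "i \<in> {2..l}" for i
  proof -
    have "prod q {i..l} = q i * prod q {i + 1..l}"
      using i by (simp add: prod.atLeast_Suc_atMost)
    moreover obtain k where "i = Suc k" "1 \<le> k" using i by (cases i) auto
    then have "prod q {2..i} = q i * prod q {2..i - 1}" by simp
    ultimately show ?thesis using q_pos[of i] i by auto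
  qed
  show ?thesis
  proof
    assume ?L
    then obtain f where f: "{e \<in> parcs G. f e \<noteq> 0} \<subseteq> cycle_edges l c \<union> (cycle_edges l c)\<inverse>"
      and nb: "nb_eigenpair G (1 - 1 / \<mu>) f" by blast
    define a where "a = (\<lambda>i. f (c i, c (succ i)))"
    define b where "b = (\<lambda>i. f (c i, c (pred i)))"
    have nz: "\<exists>i\<in>{1..l}. a i \<noteq> 0 \<or> b i \<noteq> 0"
      and a_rec: "\<forall>i\<in>{1..l}. a i = q i * a (pred i)"
      and b_rec: "\<forall>i\<in>{1..l}. b i = q i * b (succ i)"
      and ab: "\<And>i. i \<in> {1..l} \<Longrightarrow> 2 < deg G (c i) \<Longrightarrow> a i + b i = 0"
      using nb eigen[OF f, of a b] unfolding a_def b_def by blast+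
    have a: "\<And>i. i \<in> {1..l} \<Longrightarrow> a i = a 1 * prod q {2..i}" and a_1: "a 1 = a 1 * prod q {1..l}"
      using a_rec forward_recursion_iff by blast+
    have b: "\<And>i. i \<in> {2..l} \<Longrightarrow> b i = b 1 * prod q {i..l}"
      using b_rec backward_recursion_iff by blast
    have b_1: "b 1 = - a 1" using ab[OF one_in deg_1] by simp
    \<comment> \<open>Otherwise \<open>b 1 = 0\<close> too, and both recursions would make
      \<open>f\<close> vanish on all cycle edges.\<close>
    have "a 1 \<noteq> 0"
    proof
      assume 0: "a 1 = 0"
      have "a i = 0 \<and> b i = 0" if "i \<in> {1..l}" for i
        using that a[OF that] b[of i] b_1 0 by (cases "i = 1") auto
      with nz show False by blast
    qed
    moreover have "prod q {i + 1..l} = prod q {2..i - 1}" if i: "i \<in> {2..l}" "2 < deg G (c i)" for i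
    proof -
      have "i \<in> {1..l}" using i by simp
      then have "a 1 * prod q {2..i} = a 1 * prod q {i..l}"
        using ab[of i] a[of i] b[of i] b_1 i by simp
      with \<open>a 1 \<noteq> 0\<close> cancel[OF i(1)] show ?thesis by simp
    qed
    ultimately show ?R using a_1 by simp
  next
    assume R: ?R
    \<comment> \<open>These are the unrolled recursions normalised to \<open>a 1 = 1\<close> (an
      empty product) and \<open>b 1 = - 1\<close>, the sign being forced by the degree of
      \<open>c 1\<close>.\<close>
    define a where "a = (\<lambda>i. prod q {2..i})"
    define b where "b = (\<lambda>i. if i = 1 then - 1 else - prod q {i..l})"
    obtain f where f: "{e \<in> parcs G. f e \<noteq> 0} \<subseteq> cycle_edges l c \<union> (cycle_edges l c)\<inverse>"
      and "\<And>i. i \<in> {1..l} \<Longrightarrow> f (c i, c (succ i)) = a i"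
      and "\<And>i. i \<in> {1..l} \<Longrightarrow> f (c i, c (pred i)) = b i"
      by (rule function_on_cycle_exists[of a b]) (rule that)
    note fa = this(2)[symmetric] and fb = this(3)[symmetric]
    have "a 1 = 1" by (simp add: a_def)
    then have "\<exists>i\<in>{1..l}. a i \<noteq> 0 \<or> b i \<noteq> 0" using one_in by force
    moreover have "\<forall>i\<in>{1..l}. a i = q i * a (pred i)"
      unfolding forward_recursion_iff using R by (simp add: a_def)
    moreover have "\<forall>i\<in>{1..l}. b i = q i * b (succ i)"
      unfolding backward_recursion_iff using R by (simp add: b_def)
    moreover have "a i + b i = 0" if i: "i \<in> {1..l}" "2 < deg G (c i)" for i
    proof (cases "i = 1")
      case False
      then have "i \<in> {2..l}" using i by auto
      then have "prod q {2..i} = prod q {i..l}" using R i cancel by blast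
      then show ?thesis using False by (simp add: a_def b_def)
    qed (simp add: a_def b_def)
    ultimately have "nb_eigenpair G (1 - 1 / \<mu>) f" using eigen[OF f fa fb] by blast
    with f show ?L by blast
  qed
qed

section \<open>Invariance under rotation and reflection\<close>

text \<open>A relabelling permutes the indices and preserves or reverses cyclic succession. The
  reversing case says that \<open>\<sigma> (succ i)\<close> precedes \<open>\<sigma> i\<close>,
  phrased with \<open>succ\<close> alone.\<close>

lemma relabelingE:
  assumes "cycle_relabeling l c c'"
  obtains \<sigma> where "bij_betw \<sigma> {1..l} {1..l}" and "\<And>i. i \<in> {1..l} \<Longrightarrow> c' i = c (\<sigma> i)"
    and "(\<forall>i\<in>{1..l}. \<sigma> (succ i) = succ (\<sigma> i)) \<or> (\<forall>i\<in>{1..l}. succ (\<sigma> (succ i)) = \<sigma> i)"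
proof -
  have bij: "bij_betw \<sigma> {1..l} {1..l}" if "\<sigma> ` {1..l} \<subseteq> {1..l}" "inj_on \<sigma> {1..l}" for \<sigma> :: "nat \<Rightarrow> nat"
    using that endo_inj_surj by (metis bij_betw_def finite_atLeastAtMost)
  \<comment> \<open>The sum stays below twice \<open>l\<close>, so reduction subtracts
    \<open>l\<close> at most once; this turns \<open>\<sigma>\<close> into linear case
    formulas.\<close>
  have mod_l: "(x + k) mod l = (if x + k < l then x + k else x + k - l)" if "x < l" "k < l" for x k
    using that by (simp add: mod_if)
  have mod_less: "x mod l < l" for x using length_ge_3 by simp
  from assms consider k where "k < l" "\<forall>i\<in>{1..l}. c' i = c ((i - 1 + k) mod l + 1)"
    | k where "k < l" "\<forall>i\<in>{1..l}. c' i = c ((l - i + k) mod l + 1)"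
    unfolding cycle_relabeling_def by blast
  then show thesis
  proof cases
    case 1
    define \<sigma> where "\<sigma> = (\<lambda>i. (i - 1 + k) mod l + 1)"
    have in_range: "\<sigma> i \<in> {1..l}" for i using mod_less by (simp add: \<sigma>_def Suc_le_eq)
    have \<sigma>: "\<sigma> i = (if i + k \<le> l then i + k else i + k - l)" if "i \<in> {1..l}" for i
      using that mod_l[of "i - 1" k] \<open>k < l\<close> by (auto simp: \<sigma>_def)
    have "inj_on \<sigma> {1..l}"
      by (intro inj_onI) (auto simp: \<sigma> split: if_splits)
    then have "bij_betw \<sigma> {1..l} {1..l}"
      using in_range by (intro bij image_subsetI)
    moreover have "\<sigma> (succ i) = succ (\<sigma> i)" if i: "i \<in> {1..l}" for i
      unfolding succ_eq[OF in_range] unfolding \<sigma>[OF i] \<sigma>[OF succ_in[OF i]]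
      unfolding succ_eq[OF i] using i \<open>k < l\<close> by auto
    ultimately show thesis using 1 by (intro that[of \<sigma>]) (auto simp: \<sigma>_def)
  next
    case 2
    define \<sigma> where "\<sigma> = (\<lambda>i. (l - i + k) mod l + 1)"
    have in_range: "\<sigma> i \<in> {1..l}" for i using mod_less by (simp add: \<sigma>_def Suc_le_eq)
    have \<sigma>: "\<sigma> i = (if k < i then l + k + 1 - i else k + 1 - i)" if "i \<in> {1..l}" for i
      using that mod_l[of "l - i" k] \<open>k < l\<close> by (auto simp: \<sigma>_def)
    have "inj_on \<sigma> {1..l}"
      by (intro inj_onI) (auto simp: \<sigma> split: if_splits)
    then have "bij_betw \<sigma> {1..l} {1..l}"
      using in_range by (intro bij image_subsetI)
    moreover have "succ (\<sigma> (succ i)) = \<sigma> i" if i: "i \<in> {1..l}" for i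
      unfolding succ_eq[OF in_range] unfolding \<sigma>[OF i] \<sigma>[OF succ_in[OF i]]
      unfolding succ_eq[OF i] using i \<open>k < l\<close> by auto
    ultimately show thesis using 2 by (intro that[of \<sigma>]) (auto simp: \<sigma>_def)
  qed
qed

text \<open>Being cyclically adjacent is a symmetric relation, so it survives reversal as well as
  rotation; products and images are unaffected by any permutation of the indices.\<close>

lemma
  assumes "cycle_relabeling l c c'"
  shows chordless_cycle_relabeling: "chordless_cycle G l c'"
    and prod_relabeling: "(\<Prod>i = 1..l. h (c' i)) = (\<Prod>i = 1..l. (h (c i) :: real))"
    and image_relabeling: "c' ` {1..l} = c ` {1..l}"
proof -
  from assms obtain \<sigma> where bij: "bij_betw \<sigma> {1..l} {1..l}"
    and c': "\<And>i. i \<in> {1..l} \<Longrightarrow> c' i = c (\<sigma> i)"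
    and \<sigma>_succ: "(\<forall>i\<in>{1..l}. \<sigma> (succ i) = succ (\<sigma> i)) \<or> (\<forall>i\<in>{1..l}. succ (\<sigma> (succ i)) = \<sigma> i)"
    by (rule relabelingE) blast
  have \<sigma>_in: "\<sigma> i \<in> {1..l}" if "i \<in> {1..l}" for i using bij that by (rule bij_betw_apply)
  have \<sigma>_eq: "\<sigma> i = \<sigma> j \<longleftrightarrow> i = j" if "i \<in> {1..l}" "j \<in> {1..l}" for i j
    using bij that by (auto simp: bij_betw_def inj_on_eq_iff)
  have succ_\<sigma>: "(\<sigma> j = succ (\<sigma> i) \<or> \<sigma> i = succ (\<sigma> j)) \<longleftrightarrow> (j = succ i \<or> i = succ j)"
    if ij: "i \<in> {1..l}" "j \<in> {1..l}" for i j
    using \<sigma>_succ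
  proof
    assume "\<forall>i\<in>{1..l}. \<sigma> (succ i) = succ (\<sigma> i)"
    then show ?thesis using ij by (metis \<sigma>_eq succ_in)
  next
    assume "\<forall>i\<in>{1..l}. succ (\<sigma> (succ i)) = \<sigma> i"
    then show ?thesis using ij by (metis \<sigma>_eq \<sigma>_in succ_in pred_succ)
  qed
  show image: "c' ` {1..l} = c ` {1..l}"
    using c' bij by (metis (no_types, lifting) bij_betw_def image_cong image_image)
  have "inj_on c' {1..l} \<longleftrightarrow> inj_on (c \<circ> \<sigma>) {1..l}"
    by (rule inj_on_cong) (simp add: c' del: atLeastAtMost_iff One_nat_def)
  then have "inj_on c' {1..l}"
    using bij inj_c by (simp add: bij_betw_def comp_inj_on)
  moreover have "(c' i, c' j) \<in> parcs G \<longleftrightarrow> j = succ i \<or> i = succ j"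
    if "i \<in> {1..l}" "j \<in> {1..l}" for i j
    using that by (simp only: c' arc_iff \<sigma>_in succ_\<sigma>)
  ultimately have "simple_chordless_cycle G l c'"
    using length_ge_3 vertices image unfolding simple_chordless_cycle_def succ_def by simp
  with min_degree show "chordless_cycle G l c'" by unfold_locales
  show "(\<Prod>i = 1..l. h (c' i)) = (\<Prod>i = 1..l. h (c i))"
  proof -
    have "(\<Prod>i = 1..l. h (c' i)) = (\<Prod>i = 1..l. h (c (\<sigma> i)))"
      by (rule prod.cong) (simp_all add: c' del: atLeastAtMost_iff One_nat_def)
    with prod.reindex_bij_betw[OF bij, of "\<lambda>i. h (c i)"] show ?thesis by simp
  qed
qed

text \<open>A reflection exchanges \<open>cycle_edges\<close> with its converse, so only their union
  is invariant: both unions consist of the arcs inside the same vertex set.\<close>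

lemma cycle_edges_relabeling:
  assumes "cycle_relabeling l c c'"
  shows "cycle_edges l c' \<union> (cycle_edges l c')\<inverse> = cycle_edges l c \<union> (cycle_edges l c)\<inverse>"
  by (simp only: cycle_edges_Un_converse image_relabeling[OF assms]
      chordless_cycle.cycle_edges_Un_converse[OF chordless_cycle_relabeling[OF assms]])

text \<open>This identifies the root formula with the closing condition of the recursions;
  positivity of the product makes the root and the power inverse to each other.\<close>

lemma root_eq_iff_prod_eq_1:
  fixes \<mu> :: real
  assumes "0 < \<mu>"
  shows "\<mu> = root l (\<Prod>i = 1..l. real (deg G (c i)) - 1) \<longleftrightarrow>
    (\<Prod>i = 1..l. (real (deg G (c i)) - 1) / \<mu>) = 1"
proof -
  let ?P = "\<Prod>i = 1..l. real (deg G (c i)) - 1"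
  have "0 < l" using length_ge_3 by simp
  moreover have "0 < ?P" by (rule prod_pos) (use degree_minus_1_pos in blast)
  ultimately have "\<mu> = root l ?P \<longleftrightarrow> \<mu> ^ l = ?P"
    using assms by (metis less_imp_le real_root_pow_pos real_root_power_cancel)
  also have "\<dots> \<longleftrightarrow> ?P / \<mu> ^ l = 1" using assms by auto
  also have "?P / \<mu> ^ l = (\<Prod>i = 1..l. (real (deg G (c i)) - 1) / \<mu>)"
    by (simp add: prod_dividef)
  finally show ?thesis .
qed

end

theorem theorem5p6:
  fixes G :: "'a pair_pre_digraph" and l :: nat and c :: "nat \<Rightarrow> 'a" and \<mu> :: real
  assumes "pair_graph G"
    and "\<forall>v\<in>pverts G. 2 \<le> deg G v"
    and "\<not> cycle_graph G"
    and "simple_chordless_cycle G l c"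
    and "c ` {1..l} \<notin> pre_digraph.sccs_verts (with_proj G)"
    and "0 < \<mu>"
  shows "(\<exists>f. nb_eigenpair G (1 - 1 / \<mu>) f \<and>
            {e \<in> parcs G. f e \<noteq> 0} \<subseteq> cycle_edges l c \<union> (cycle_edges l c)\<inverse>) \<longleftrightarrow>
         \<mu> = root l (\<Prod>i = 1..l. real (deg G (c i)) - 1) \<and>
         (\<exists>c'. cycle_relabeling l c c' \<and> 2 < deg G (c' 1) \<and>
            (\<forall>i\<in>{2..l}. 2 < deg G (c' i) \<longrightarrow>
               \<mu> / (real (deg G (c' 1)) - 1) * (\<Prod>j = i + 1..l. \<mu> / (real (deg G (c' j)) - 1)) =
               \<mu> / (real (deg G (c' 1)) - 1) * (\<Prod>j = 2..i - 1. \<mu> / (real (deg G (c' j)) - 1))))"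
proof -
  interpret C: chordless_cycle G l c
    using assms by (simp add: chordless_cycle_def chordless_cycle_axioms_def)
  let ?q = "\<lambda>c i. (real (deg G (c i)) - 1) / \<mu>"
  \<comment> \<open>The left side and the root condition do not involve \<open>c'\<close>. Hence one
    suitable relabelling yields the forward direction, and any relabelling supplied by the right
    side yields the converse.\<close>
  have relabeled: "(\<exists>f. nb_eigenpair G (1 - 1 / \<mu>) f \<and>
      {e \<in> parcs G. f e \<noteq> 0} \<subseteq> cycle_edges l c \<union> (cycle_edges l c)\<inverse>) \<longleftrightarrow>
    \<mu> = root l (\<Prod>i = 1..l. real (deg G (c i)) - 1) \<and>
    (\<forall>i\<in>{2..l}. 2 < deg G (c' i) \<longrightarrow>
       \<mu> / (real (deg G (c' 1)) - 1) * (\<Prod>j = i + 1..l. \<mu> / (real (deg G (c' j)) - 1)) =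
       \<mu> / (real (deg G (c' 1)) - 1) * (\<Prod>j = 2..i - 1. \<mu> / (real (deg G (c' j)) - 1)))"
    if c': "cycle_relabeling l c c'" "2 < deg G (c' 1)" for c'
  proof -
    interpret C': chordless_cycle G l c' by (rule C.chordless_cycle_relabeling[OF c'(1)])
    \<comment> \<open>The products in the statement are inverses of products of \<open>?q\<close>,
      and the nonzero factor belonging to \<open>c' 1\<close> cancels from both sides.\<close>
    have "(\<Prod>j\<in>J. \<mu> / (real (deg G (c' j)) - 1)) = inverse (prod (?q c') J)" for J
      by (simp flip: prod_inversef)
    then have "\<mu> / (real (deg G (c' 1)) - 1) * (\<Prod>j = i + 1..l. \<mu> / (real (deg G (c' j)) - 1)) =
        \<mu> / (real (deg G (c' 1)) - 1) * (\<Prod>j = 2..i - 1. \<mu> / (real (deg G (c' j)) - 1)) \<longleftrightarrow>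
        prod (?q c') {i + 1..l} = prod (?q c') {2..i - 1}" for i
      using c'(2) \<open>0 < \<mu>\<close> by simp
    then show ?thesis
      using C'.eigenfunction_on_cycle_iff[OF \<open>0 < \<mu>\<close> c'(2)] C.root_eq_iff_prod_eq_1[OF \<open>0 < \<mu>\<close>]
        C.prod_relabeling[OF c'(1), of "\<lambda>v. (real (deg G v) - 1) / \<mu>"]
      by (simp only: C.cycle_edges_relabeling[OF c'(1)])
  qed
  obtain k where k: "k \<in> {1..l}" "2 < deg G (c k)"
    using C.exists_degree_gt_2[OF assms(5)] by blast
  \<comment> \<open>Rotation by \<open>k - 1\<close>, as indices start at 1, moves the vertex
    \<open>c k\<close> of degree above 2 to the first position.\<close>
  define c' where "c' = (\<lambda>i. c ((i - 1 + (k - 1)) mod l + 1))"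
  have "k - 1 < l" using k by auto
  then have c': "cycle_relabeling l c c'" unfolding cycle_relabeling_def c'_def by blast
  have "c' 1 = c k" using k by (auto simp: c'_def)
  with k have deg: "2 < deg G (c' 1)" by simp
  show ?thesis (is "?E \<longleftrightarrow> ?R")
  proof
    assume ?E
    with relabeled[OF c' deg] c' deg show ?R by blast
  next
    assume ?R
    then show ?E by (elim conjE exE) (use relabeled in blast)
  qed
qed

end
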